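(* Let $\mathbf P^{(1)}$ be a $(K_1,F_1,Z_1,S_1)$ PDA in which each integer of $[S_1]$ appears more than once, and let $\mathbf P^{(2)}$ be a $(K_2,F_2,Z_2,S_2)$ PDA with $K_2>1$. Let $\mathbf P$ be the $F_1F_2\times K_1K_2$ array obtained from $\mathbf P^{(1)}$ by replacing each integer entry $s\in[S_1]$ by the $F_2\times K_2$ block $\mathbf P^{(2)}+(s-1)S_2$ (where $*+(s-1)S_2=*$), and replacing each entry $*$ by the $F_2\times K_2$ block all of whose entries are $*$. Then $\mathbf P$ is a $$\big(K_1K_2,\ F_1F_2,\ Z_1F_2+(F_1-Z_1)Z_2,\ S_1S_2\big)$$ PDA.
   Context: Notation: $[n]=\{1,\dots,n\}$; for an array $A$ and integer $b$, $A+b$ is obtained by adding $b$ to every integer entry (stars are unchanged). PDA. For positive integers $K,F,Z,S$, an $F\times K$ array $P=[p_{f,k}]$ with entries in $\{*\}\cup[S]$ is a $(K,F,Z,S)$ placement delivery array (PDA) if: (A1) the symbol $*$ appears exactly $Z$ times in each column; (A2) each integer of $[S]$ occurs at least once in the array; (A3) whenever two distinct entries $p_{f_1,k_1}$ and $p_{f_2,k_2}$ are equal to the same integer, then $f_1\ne f_2$, $k_1\neq k_2$, and $p_{f_1,k_2}=p_{f_2,k_1}=*$. *)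

theory Defs
  imports "Jordan_Normal_Form.Matrix"
begin

(* Array entries have type "nat option": None is the star and Some s is the integer s.
   Rows and columns are indexed from 0, as for all matrices of the library, whereas the
   integer entries range over [S] = {1..S}. *)

definition is_PDA :: "nat \<Rightarrow> nat \<Rightarrow> nat \<Rightarrow> nat \<Rightarrow> nat option mat \<Rightarrow> bool" where
  "is_PDA K F Z S P \<longleftrightarrow>
     K > 0 \<and> F > 0 \<and> Z > 0 \<and> S > 0 \<and>
     P \<in> carrier_mat F K \<and>
     (\<forall>f<F. \<forall>k<K. P $$ (f, k) \<in> insert None (Some ` {1..S})) \<and>
     (\<forall>k<K. card {f. f < F \<and> P $$ (f, k) = None} = Z) \<and>
     (\<forall>s\<in>{1..S}. \<exists>f<F. \<exists>k<K. P $$ (f, k) = Some s) \<and>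
     (\<forall>f1<F. \<forall>k1<K. \<forall>f2<F. \<forall>k2<K. \<forall>s.
        (f1, k1) \<noteq> (f2, k2) \<and> P $$ (f1, k1) = Some s \<and> P $$ (f2, k2) = Some s \<longrightarrow>
        f1 \<noteq> f2 \<and> k1 \<noteq> k2 \<and> P $$ (f1, k2) = None \<and> P $$ (f2, k1) = None)"

definition occurrences :: "nat option mat \<Rightarrow> nat \<Rightarrow> (nat \<times> nat) set" where
  "occurrences P s = {(f, k). f < dim_row P \<and> k < dim_col P \<and> P $$ (f, k) = Some s}"

(* The array A + b. *)
definition shift_array :: "nat option mat \<Rightarrow> nat \<Rightarrow> nat option mat" where
  "shift_array A b = map_mat (map_option (\<lambda>s. s + b)) A"

definition star_array :: "nat \<Rightarrow> nat \<Rightarrow> nat option mat" where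
  "star_array F K = mat F K (\<lambda>_. None)"

(* The block put in place of an entry of the outer array. The subtraction on nat is the
   intended one, since the integers of a PDA are at least 1. *)
definition entry_block :: "nat \<Rightarrow> nat option mat \<Rightarrow> nat option \<Rightarrow> nat option mat" where
  "entry_block S2 P2 e =
     (case e of None \<Rightarrow> star_array (dim_row P2) (dim_col P2)
              | Some s \<Rightarrow> shift_array P2 ((s - 1) * S2))"

definition compose_array :: "nat \<Rightarrow> nat option mat \<Rightarrow> nat option mat \<Rightarrow> nat option mat" where
  "compose_array S2 P1 P2 =
     mat (dim_row P1 * dim_row P2) (dim_col P1 * dim_col P2)
       (\<lambda>(f, k). entry_block S2 P2 (P1 $$ (f div dim_row P2, k div dim_col P2))
                   $$ (f mod dim_row P2, k mod dim_col P2))"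

end

(* An integer x of the composed array is a + (s - 1) * S2 for exactly one pair (s, a), so equal
   entries come from equal outer entries s and equal inner entries a. Two such entries in the
   same block are separated by (A3) for the inner array; in different blocks, (A3) for the
   outer array makes both opposite blocks consist of stars only. *)

theory Submission
  imports Defs
begin

text \<open>The bounds on \<open>f\<close> and \<open>k\<close> force \<open>F2\<close> and
  \<open>K2\<close> to be positive, so the remainders are legal indices into the inserted block and
  the lookup there evaluates. All later reasoning about entries uses this form.\<close>

lemma index_compose_array:
  assumes "P1 \<in> carrier_mat F1 K1" "P2 \<in> carrier_mat F2 K2"
    and "f < F1 * F2" "k < K1 * K2"
  shows "compose_array S2 P1 P2 $$ (f, k) =
    (case P1 $$ (f div F2, k div K2) of None \<Rightarrow> None
     | Some s \<Rightarrow> map_option (\<lambda>t. t + (s - 1) * S2) (P2 $$ (f mod F2, k mod K2)))"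
proof -
  have "0 < F2" "0 < K2"
    using assms(3,4) by (auto intro: Nat.gr0I)
  then have "f mod F2 < dim_row P2" "k mod K2 < dim_col P2"
    using assms(2) by auto
  then show ?thesis
    using assms by (auto simp: compose_array_def entry_block_def star_array_def
        shift_array_def split: option.split)
qed

text \<open>After subtracting 1, \<open>a - 1\<close> and \<open>s - 1\<close> are remainder and
  quotient modulo \<open>n\<close>, hence determined by the sum. The bounds \<open>1 \<le> s\<close>
  and \<open>1 \<le> t\<close> let \<open>s = t\<close> be recovered from the truncated
  differences.\<close>

lemma mult_add_digit_eq_iff:
  fixes a b s t n :: nat
  assumes "a \<in> {1..n}" "b \<in> {1..n}" "1 \<le> s" "1 \<le> t"
  shows "a + (s - 1) * n = b + (t - 1) * n \<longleftrightarrow> a = b \<and> s = t"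
proof
  assume eq: "a + (s - 1) * n = b + (t - 1) * n"
  have "(a - 1) + (s - 1) * n = (b - 1) + (t - 1) * n"
    using eq assms by auto
  moreover have lt: "a - 1 < n" "b - 1 < n"
    using assms by auto
  ultimately have "((a - 1) + (s - 1) * n) div n = ((b - 1) + (t - 1) * n) div n"
    by simp
  then have "s - 1 = t - 1"
    using lt by simp
  then show "a = b \<and> s = t"
    using eq assms by auto
qed auto

text \<open>Passes from a global index to the pair (block, position inside the block). The inverse
  is \<open>q * n + r\<close>, which stays in range because it lies below \<open>Suc q * n\<close>;
  for \<open>n = 0\<close> both sides are empty.\<close>

lemma bij_betw_divmod:
  fixes m n :: nat
  shows "bij_betw (\<lambda>f. (f div n, f mod n)) {..<m * n} ({..<m} \<times> {..<n})"
proof (rule bij_betw_byWitness[where f' = "\<lambda>(q, r). q * n + r"])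
  show "(\<lambda>f. (f div n, f mod n)) ` {..<m * n} \<subseteq> {..<m} \<times> {..<n}"
    by (cases "n = 0") (auto simp: less_mult_imp_div_less)
  have "q * n + r < m * n" if "q < m" "r < n" for q r
  proof -
    have "q * n + r < Suc q * n" using that by simp
    also have "\<dots> \<le> m * n" using that by (intro mult_le_mono1) simp
    finally show ?thesis .
  qed
  then show "(\<lambda>(q, r). q * n + r) ` ({..<m} \<times> {..<n}) \<subseteq> {..<m * n}"
    by auto
qed auto

text \<open>Surjectivity of the bijection above: it supplies a global index for a prescribed block
  and inner position.\<close>

lemma ex_divmod:
  fixes m n q r :: nat
  assumes "q < m" "r < n"
  shows "\<exists>f<m * n. f div n = q \<and> f mod n = r"
proof -
  have "(q, r) \<in> (\<lambda>f. (f div n, f mod n)) ` {..<m * n}"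
    using assms bij_betw_imp_surj_on[OF bij_betw_divmod[of n m]] by simp
  then show ?thesis by auto
qed

lemma card_divmod_Collect:
  fixes m n :: nat
  shows "card {f. f < m * n \<and> R (f div n) (f mod n)} =
    card {(q, r). q < m \<and> r < n \<and> R q r}"
  using bij_betw_same_card[OF bij_betw_Collect[OF bij_betw_divmod[of n m],
        of "\<lambda>(q, r). R q r" "\<lambda>f. R (f div n) (f mod n)"]]
  by (simp add: lessThan_def case_prod_unfold conj_assoc mem_Times_iff)

text \<open>Pairs are sorted by whether \<open>A q\<close> holds: if it does, all \<open>n\<close>
  remainders count, otherwise only those satisfying \<open>B\<close>. The two families are disjoint,
  so their sizes add up. With \<open>A\<close> and \<open>B\<close> marking the stars of an outer
  and an inner column, this is the star count of a composed column.\<close>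

lemma card_divmod_disj:
  fixes m n :: nat
  shows "card {f. f < m * n \<and> (A (f div n) \<or> B (f mod n))} =
    card {q. q < m \<and> A q} * n + (m - card {q. q < m \<and> A q}) * card {r. r < n \<and> B r}"
proof -
  let ?A = "{q. q < m \<and> A q}" and ?B = "{r. r < n \<and> B r}"
  have "{(q, r). q < m \<and> r < n \<and> (A q \<or> B r)} = ?A \<times> {..<n} \<union> ({..<m} - ?A) \<times> ?B"
    by auto
  moreover have "card ({..<m} - ?A) = m - card ?A"
    by (subst card_Diff_subset) auto
  moreover have "card (?A \<times> {..<n} \<union> ({..<m} - ?A) \<times> ?B) =
      card (?A \<times> {..<n}) + card (({..<m} - ?A) \<times> ?B)"
    by (intro card_Un_disjoint) auto
  ultimately show ?thesis
    using card_divmod_Collect[of m n "\<lambda>q r. A q \<or> B r"] by (simp add: card_cartesian_product)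
qed

text \<open>Breaks the definition into rules that can be instantiated separately. The range
  condition is recast for integer entries only, where it bounds the integer.\<close>

lemma is_PDA_D:
  assumes "is_PDA K F Z S P"
  shows is_PDA_pos: "0 < K" "0 < F" "0 < Z" "0 < S"
    and is_PDA_carrier: "P \<in> carrier_mat F K"
    and is_PDA_range: "\<lbrakk>f < F; k < K; P $$ (f, k) = Some s\<rbrakk> \<Longrightarrow> s \<in> {1..S}"
    and is_PDA_stars: "k < K \<Longrightarrow> card {f. f < F \<and> P $$ (f, k) = None} = Z"
    and is_PDA_surj: "s \<in> {1..S} \<Longrightarrow> \<exists>f<F. \<exists>k<K. P $$ (f, k) = Some s"
    and is_PDA_cross: "\<lbrakk>f1 < F; k1 < K; f2 < F; k2 < K; (f1, k1) \<noteq> (f2, k2);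
      P $$ (f1, k1) = Some s; P $$ (f2, k2) = Some s\<rbrakk> \<Longrightarrow>
      f1 \<noteq> f2 \<and> k1 \<noteq> k2 \<and> P $$ (f1, k2) = None \<and> P $$ (f2, k1) = None"
proof -
  have pos: "0 < K" "0 < F" "0 < Z" "0 < S"
    and carrier: "P \<in> carrier_mat F K"
    and range: "\<forall>f<F. \<forall>k<K. P $$ (f, k) \<in> insert None (Some ` {1..S})"
    and stars: "\<forall>k<K. card {f. f < F \<and> P $$ (f, k) = None} = Z"
    and surj: "\<forall>s\<in>{1..S}. \<exists>f<F. \<exists>k<K. P $$ (f, k) = Some s"
    and cross: "\<forall>f1<F. \<forall>k1<K. \<forall>f2<F. \<forall>k2<K. \<forall>s.
        (f1, k1) \<noteq> (f2, k2) \<and> P $$ (f1, k1) = Some s \<and> P $$ (f2, k2) = Some s \<longrightarrow>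
        f1 \<noteq> f2 \<and> k1 \<noteq> k2 \<and> P $$ (f1, k2) = None \<and> P $$ (f2, k1) = None"
    using assms unfolding is_PDA_def by - (elim conjE; assumption)+
  show "0 < K" "0 < F" "0 < Z" "0 < S" "P \<in> carrier_mat F K"
    by fact+
  show "s \<in> {1..S}" if "f < F" "k < K" "P $$ (f, k) = Some s"
    using range[rule_format, OF that(1,2)] that(3) by auto
  show "card {f. f < F \<and> P $$ (f, k) = None} = Z" if "k < K"
    using stars[rule_format, OF that] .
  show "\<exists>f<F. \<exists>k<K. P $$ (f, k) = Some s" if "s \<in> {1..S}"
    using surj[rule_format, OF that] .
  show "f1 \<noteq> f2 \<and> k1 \<noteq> k2 \<and> P $$ (f1, k2) = None \<and> P $$ (f2, k1) = None"
    if "f1 < F" "k1 < K" "f2 < F" "k2 < K" "(f1, k1) \<noteq> (f2, k2)"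
      "P $$ (f1, k1) = Some s" "P $$ (f2, k2) = Some s"
    using cross[rule_format, OF that(1-4) conjI[OF that(5) conjI[OF that(6,7)]]] .
qed

theorem mainTheorem4:
  fixes K1 F1 Z1 S1 K2 F2 Z2 S2 :: nat
    and P1 P2 :: "nat option mat"
  assumes "is_PDA K1 F1 Z1 S1 P1"
    and "\<forall>s\<in>{1..S1}. card (occurrences P1 s) > 1"
    and "is_PDA K2 F2 Z2 S2 P2"
    and "K2 > 1"
  shows "is_PDA (K1 * K2) (F1 * F2) (Z1 * F2 + (F1 - Z1) * Z2) (S1 * S2)
           (compose_array S2 P1 P2)"
proof -
  let ?P = "compose_array S2 P1 P2"
  note pos = is_PDA_pos[OF assms(1)] is_PDA_pos[OF assms(3)]
  note carrier = is_PDA_carrier[OF assms(1)] is_PDA_carrier[OF assms(3)]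
  note index = index_compose_array[OF carrier]
  have div_mod: "f div F2 < F1" "f mod F2 < F2" if "f < F1 * F2" for f
    using that pos by (auto simp: less_mult_imp_div_less)
  have div_mod': "k div K2 < K1" "k mod K2 < K2" if "k < K1 * K2" for k
    using that pos by (auto simp: less_mult_imp_div_less)
  have entryE: "\<exists>s a. s \<in> {1..S1} \<and> a \<in> {1..S2} \<and> x = a + (s - 1) * S2 \<and>
      P1 $$ (f div F2, k div K2) = Some s \<and> P2 $$ (f mod F2, k mod K2) = Some a"
    if "f < F1 * F2" "k < K1 * K2" "?P $$ (f, k) = Some x" for f k x
    using that is_PDA_range[OF assms(1) div_mod(1) div_mod'(1), of f k]
      is_PDA_range[OF assms(3) div_mod(2) div_mod'(2), of f k]
    by (auto simp: index split: option.splits)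
  have carrier_P: "?P \<in> carrier_mat (F1 * F2) (K1 * K2)"
    using carrier by (auto simp: compose_array_def)
  have range_P: "?P $$ (f, k) \<in> insert None (Some ` {1..S1 * S2})"
    if bounds: "f < F1 * F2" "k < K1 * K2" for f k
  proof (cases "?P $$ (f, k)")
    case (Some x)
    then obtain s a where s: "s \<in> {1..S1}" and a: "a \<in> {1..S2}" and x: "x = a + (s - 1) * S2"
      using entryE[OF bounds Some] by blast
    \<comment> \<open>Since \<open>a \<le> S2\<close>, block \<open>s\<close> reaches at most
      \<open>s * S2\<close>; here \<open>Suc (s - 1)\<close> is \<open>s\<close> because
      \<open>s\<close> is at least 1.\<close>
    have "x \<le> Suc (s - 1) * S2" using a x by simp
    also have "\<dots> \<le> S1 * S2" using s by (intro mult_le_mono1) simp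
    finally show ?thesis using Some a x by auto
  qed simp
  have stars_P: "card {f. f < F1 * F2 \<and> ?P $$ (f, k) = None} = Z1 * F2 + (F1 - Z1) * Z2"
    if k: "k < K1 * K2" for k
  proof -
    \<comment> \<open>Shifting preserves stars, so an entry is a star exactly when its outer or its
      inner entry is one.\<close>
    have "{f. f < F1 * F2 \<and> ?P $$ (f, k) = None} =
      {f. f < F1 * F2 \<and> (P1 $$ (f div F2, k div K2) = None \<or> P2 $$ (f mod F2, k mod K2) = None)}"
      using k by (auto simp: index split: option.splits)
    then show ?thesis
      using card_divmod_disj[of F1 F2 "\<lambda>q. P1 $$ (q, k div K2) = None"
          "\<lambda>r. P2 $$ (r, k mod K2) = None"] div_mod'[OF k]
      by (simp add: is_PDA_stars[OF assms(1)] is_PDA_stars[OF assms(3)])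
  qed
  have surj_P: "\<exists>f<F1 * F2. \<exists>k<K1 * K2. ?P $$ (f, k) = Some x"
    if x: "x \<in> {1..S1 * S2}" for x
  proof -
    \<comment> \<open>The two digits of \<open>x - 1\<close> in base \<open>S2\<close>, each raised
      by 1 because the integers of an array start at 1.\<close>
    define s a where "s = Suc ((x - 1) div S2)" and "a = Suc ((x - 1) mod S2)"
    have "x - 1 < S1 * S2" using x by auto
    then have range: "s \<in> {1..S1}" "a \<in> {1..S2}"
      using pos by (auto simp: s_def a_def less_mult_imp_div_less Suc_le_eq)
    obtain q l where ql: "q < F1" "l < K1" "P1 $$ (q, l) = Some s"
      using is_PDA_surj[OF assms(1) range(1)] by blast
    obtain r c where rc: "r < F2" "c < K2" "P2 $$ (r, c) = Some a"
      using is_PDA_surj[OF assms(3) range(2)] by blast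
    obtain f where f: "f < F1 * F2" "f div F2 = q" "f mod F2 = r"
      using ex_divmod[OF ql(1) rc(1)] by blast
    obtain k where k: "k < K1 * K2" "k div K2 = l" "k mod K2 = c"
      using ex_divmod[OF ql(2) rc(2)] by blast
    have "a + (s - 1) * S2 = x"
      using x by (simp add: s_def a_def)
    then show ?thesis
      using f k ql(3) rc(3) by (intro exI[of _ f] exI[of _ k] conjI) (simp_all add: index)
  qed
  have cross_P: "f1 \<noteq> f2 \<and> k1 \<noteq> k2 \<and> ?P $$ (f1, k2) = None \<and> ?P $$ (f2, k1) = None"
    if bounds: "f1 < F1 * F2" "k1 < K1 * K2" "f2 < F1 * F2" "k2 < K1 * K2"
      and ne: "(f1, k1) \<noteq> (f2, k2)"
      and x: "?P $$ (f1, k1) = Some x" "?P $$ (f2, k2) = Some x" for f1 k1 f2 k2 x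
  proof -
    obtain s a where sa: "s \<in> {1..S1}" "a \<in> {1..S2}" "x = a + (s - 1) * S2"
      "P1 $$ (f1 div F2, k1 div K2) = Some s" "P2 $$ (f1 mod F2, k1 mod K2) = Some a"
      using entryE[OF bounds(1,2) x(1)] by blast
    obtain t b where tb: "t \<in> {1..S1}" "b \<in> {1..S2}" "x = b + (t - 1) * S2"
      "P1 $$ (f2 div F2, k2 div K2) = Some t" "P2 $$ (f2 mod F2, k2 mod K2) = Some b"
      using entryE[OF bounds(3,4) x(2)] by blast
    have eq: "b = a" "t = s"
      using mult_add_digit_eq_iff[of a S2 b s t] sa(1-3) tb(1-3) by auto
    note lt1 = div_mod(1)[OF bounds(1)] div_mod'(1)[OF bounds(2)]
      div_mod(1)[OF bounds(3)] div_mod'(1)[OF bounds(4)]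
    note lt2 = div_mod(2)[OF bounds(1)] div_mod'(2)[OF bounds(2)]
      div_mod(2)[OF bounds(3)] div_mod'(2)[OF bounds(4)]
    show ?thesis
    proof (cases "(f1 div F2, k1 div K2) = (f2 div F2, k2 div K2)")
      case False
      have "f1 div F2 \<noteq> f2 div F2 \<and> k1 div K2 \<noteq> k2 div K2 \<and>
          P1 $$ (f1 div F2, k2 div K2) = None \<and> P1 $$ (f2 div F2, k1 div K2) = None"
        using is_PDA_cross[OF assms(1) lt1 False sa(4)] tb(4) eq(2) by blast
      \<comment> \<open>Indices with different quotients are different.\<close>
      moreover from this have "f1 \<noteq> f2" "k1 \<noteq> k2"
        by blast+
      ultimately show ?thesis
        by (simp only: index bounds) simp
    next
      case True
      \<comment> \<open>An index is determined by its quotient and remainder, so distinct positions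
        in one block differ in their remainders.\<close>
      then have "(f1 mod F2, k1 mod K2) \<noteq> (f2 mod F2, k2 mod K2)"
        using ne by (metis Pair_inject div_mult_mod_eq)
      then have "f1 mod F2 \<noteq> f2 mod F2 \<and> k1 mod K2 \<noteq> k2 mod K2 \<and>
          P2 $$ (f1 mod F2, k2 mod K2) = None \<and> P2 $$ (f2 mod F2, k1 mod K2) = None"
        using is_PDA_cross[OF assms(3) lt2 _ sa(5)] tb(5) eq(1) by blast
      moreover from this have "f1 \<noteq> f2" "k1 \<noteq> k2"
        by blast+
      \<comment> \<open>An inner star gives a star of the composed array whether the outer entry is
        a star or an integer, so the case split closes both crossing positions.\<close>
      ultimately show ?thesis
        by (simp only: index bounds) (simp split: option.split)
    qed
  qed
  \<comment> \<open>The star count is positive because its first summand \<open>Z1 * F2\<close>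
    is.\<close>
  have pos_P: "0 < K1 * K2" "0 < F1 * F2" "0 < Z1 * F2 + (F1 - Z1) * Z2" "0 < S1 * S2"
    using pos by simp_all
  show ?thesis
    unfolding is_PDA_def
    by (intro conjI; (intro allI impI ballI)?; (elim conjE)?;
        rule pos_P carrier_P range_P stars_P surj_P cross_P; assumption)
qed

end
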